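(* Assume the following statement (H): for all positive integers $a$ and $m$ with $m>1$, if $a<p$ where $p$ is the least prime divisor of $m$, and $m\mid\varphi(am+1)$, then $am+1$ is prime. Under (H), the following holds: let $a$ and $m>1$ be positive integers, let $p$ be the least prime divisor of $m$, suppose $a<p$, and let $n=am+1$. If for each prime $q$ dividing $m$ there exists an integer $b$ (depending on $q$) such that $b^{n-1}\equiv 1\pmod n$ and $b^{(n-1)/q}\not\equiv 1\pmod n$, then $n$ is prime.
   Context: $\varphi$ denotes Euler's totient function. The statement (H) is a conjecture in the paper; the theorem is conditional on it. *)

theory Defs
  imports "HOL-Number_Theory.Number_Theory"
begin

text \<open>Only meaningful for \<open>m > 1\<close>; for \<open>m = 1\<close> no prime divisor exists and \<open>LEAST\<close> is unspecified.\<close>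

definition least_prime_divisor :: "nat \<Rightarrow> nat" where
  "least_prime_divisor m = (LEAST p. prime p \<and> p dvd m)"

text \<open>The conjecture (H), which the theorem takes as a hypothesis.\<close>

definition hypothesis_H :: bool where
  "hypothesis_H \<longleftrightarrow>
     (\<forall>a m :: nat. a > 0 \<longrightarrow> m > 1 \<longrightarrow> a < least_prime_divisor m \<longrightarrow>
        m dvd totient (a * m + 1) \<longrightarrow> prime (a * m + 1))"

end

(* For a prime q dividing n - 1 = a m, the order d of the witness b modulo n divides n - 1 but not
   (n - 1) / q, so d has the same q-adic valuation as n - 1. As d divides totient n, comparing
   valuations at all primes dividing m shows that m divides totient n, and (H) applies. *)
theory Submission
  imports Defs
begin

text \<open>If \<open>q\<close> divided the cofactor \<open>e\<close> in \<open>N = d * e\<close>,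
  one factor \<open>q\<close> could be cancelled from \<open>e\<close>, leaving \<open>d\<close> a
  divisor of \<open>N div q\<close>. Hence every factor \<open>q\<close> of \<open>N\<close> already
  lies in \<open>d\<close>.\<close>

lemma multiplicity_le_of_dvd_not_dvd_div:
  fixes d N q :: nat
  assumes "prime q" "q dvd N" "N > 0" "d dvd N" "\<not> d dvd N div q"
  shows "multiplicity q N \<le> multiplicity q d"
proof -
  obtain e where e: "N = d * e" using \<open>d dvd N\<close> by blast
  have "\<not> q dvd e"
  proof
    assume "q dvd e"
    then have "N div q = d * (e div q)" by (simp add: e div_mult_swap)
    then show False using assms(5) by simp
  qed
  moreover have "multiplicity q N = multiplicity q d + multiplicity q e"
    unfolding e using assms e by (intro prime_elem_multiplicity_mult_distrib) auto
  ultimately show ?thesis by (simp add: not_dvd_imp_multiplicity_0)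
qed

lemma multiplicity_le_multiplicity_totient:
  fixes b :: int and n N q :: nat
  assumes "prime q" "q dvd N" "N > 0" "n > 0"
    and "[b ^ N = 1] (mod int n)" "\<not> [b ^ (N div q) = 1] (mod int n)"
  shows "multiplicity q N \<le> multiplicity q (totient n)"
proof -
  \<comment> \<open>\<open>ord\<close> is applied to naturals here, so the integer witness is
    replaced by its least nonnegative residue, which has the same powers modulo
    \<open>n\<close>.\<close>
  define c where "c = nat (b mod int n)"
  have pow_iff: "[c ^ k = 1] (mod n) \<longleftrightarrow> [b ^ k = 1] (mod int n)" for k
  proof -
    have "[int c = b] (mod int n)" using \<open>n > 0\<close> by (simp add: c_def cong_def)
    then have "[int c ^ k = b ^ k] (mod int n)" by (rule cong_pow)
    moreover have "[c ^ k = 1] (mod n) \<longleftrightarrow> [int c ^ k = 1] (mod int n)"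
      by (metis cong_int_iff of_nat_1 of_nat_power)
    ultimately show ?thesis by (meson cong_sym cong_trans)
  qed
  have "ord n c dvd N" "\<not> ord n c dvd N div q"
    using assms pow_iff by (simp_all flip: ord_divides)
  then have "multiplicity q N \<le> multiplicity q (ord n c)"
    using assms by (intro multiplicity_le_of_dvd_not_dvd_div)
  \<comment> \<open>Without coprimality \<open>ord n c\<close> takes the default value 0, which
    cannot divide the positive \<open>N\<close>.\<close>
  moreover have "coprime n c"
    using \<open>ord n c dvd N\<close> \<open>N > 0\<close> by (metis dvd_0_left_iff less_numeral_extra(3) ord_eq_0)
  then have "ord n c dvd totient n" by (rule order_divides_totient)
  then have "multiplicity q (ord n c) \<le> multiplicity q (totient n)"
    using \<open>n > 0\<close> by (intro dvd_imp_multiplicity_le) auto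
  ultimately show ?thesis by simp
qed

theorem theorem4p2:
  fixes a m p n :: nat
  assumes H: "hypothesis_H"
    and a_pos: "a > 0"
    and m_gt_1: "m > 1"
    and p_def: "p = least_prime_divisor m"
    and a_less_p: "a < p"
    and n_def: "n = a * m + 1"
    and witnesses: "\<And>q. prime q \<Longrightarrow> q dvd m \<Longrightarrow>
          \<exists>b :: int. [b ^ (n - 1) = 1] (mod int n) \<and> \<not> [b ^ ((n - 1) div q) = 1] (mod int n)"
  shows "prime n"
proof -
  \<comment> \<open>Working one prime at a time lets each \<open>q\<close> use its own witness
    \<open>b\<close>.\<close>
  have "m dvd totient n"
  proof (rule multiplicity_le_imp_dvd)
    show "m \<noteq> 0" using m_gt_1 by simp
    fix q :: nat assume q: "prime q"
    show "multiplicity q m \<le> multiplicity q (totient n)"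
    proof (cases "q dvd m")
      case False
      then show ?thesis by (simp add: not_dvd_imp_multiplicity_0)
    next
      case True
      \<comment> \<open>The witnesses concern \<open>n - 1 = a * m\<close>, so the valuation of
        \<open>m\<close> is bounded through this nonzero multiple.\<close>
      have "n - 1 > 0" "m dvd n - 1" using a_pos m_gt_1 by (simp_all add: n_def)
      then have "multiplicity q m \<le> multiplicity q (n - 1)"
        by (intro dvd_imp_multiplicity_le) auto
      also have "\<dots> \<le> multiplicity q (totient n)"
        using witnesses[OF q True] q True \<open>n - 1 > 0\<close> \<open>m dvd n - 1\<close>
        by (auto intro: multiplicity_le_multiplicity_totient dvd_trans)
      finally show ?thesis .
    qed
  qed
  then show ?thesis
    using H a_pos m_gt_1 a_less_p by (simp add: hypothesis_H_def n_def p_def)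
qed

end
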